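(* For the empty configuration (no points, lines or curves) there exists an admissible set $\Sigma\subset\mathbb R^2$ such that no two lines, each passing through two distinct points of $\Sigma$, are perpendicular. In particular, a pair of perpendicular lines cannot be constructed using only a straightedge.
   Context: A configuration is a finite collection of points $a_i\in\mathbb R^2$, lines $\ell_i\subset\mathbb R^2$ and curves $\gamma_i\subset\mathbb R^2$. Given a configuration $\{a_i,\ell_i,\gamma_i\}$, call a set $\Sigma\subset\mathbb R^2$ admissible if: (1) $\Sigma$ is dense in $\mathbb R^2$; (2) every $a_i$ lies in $\Sigma$; (3) for any $b_1,b_2,b_3,b_4\in\Sigma$ with $b_1\neq b_2$, $b_3\ne b_4$, if the lines $b_1b_2$ and $b_3b_4$ are distinct and not parallel, then their intersection point lies in $\Sigma$; (4) for any distinct $b_1,b_2\in\Sigma$, every isolated intersection point of the line $b_1b_2$ with any of the lines $\ell_i$ or curves $\gamma_j$ lies in $\Sigma$. For the empty configuration, conditions (2) and (4) are vacuous. *)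

theory Defs
  imports "HOL-Analysis.Analysis"
begin

type_synonym pt = "real \<times> real"

text \<open>The line through two points b1, b2 (meant for b1 \<noteq> b2).\<close>
definition line_through :: "pt \<Rightarrow> pt \<Rightarrow> pt set" where
  "line_through b1 b2 = {p. \<exists>t::real. p = b1 + t *\<^sub>R (b2 - b1)}"

definition cross2 :: "pt \<Rightarrow> pt \<Rightarrow> real" where
  "cross2 u v = fst u * snd v - snd u * fst v"

definition lines_parallel :: "pt \<Rightarrow> pt \<Rightarrow> pt \<Rightarrow> pt \<Rightarrow> bool" where
  "lines_parallel b1 b2 b3 b4 \<longleftrightarrow> cross2 (b2 - b1) (b4 - b3) = 0"

definition isolated_pt_of :: "pt \<Rightarrow> pt set \<Rightarrow> bool" where
  "isolated_pt_of p S \<longleftrightarrow> p \<in> S \<and> (\<exists>e>0. S \<inter> ball p e = {p})"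

definition admissible :: "pt set \<Rightarrow> pt set set \<Rightarrow> pt set set \<Rightarrow> pt set \<Rightarrow> bool" where
  "admissible A Ls Cs \<Sigma> \<longleftrightarrow>
     closure \<Sigma> = UNIV \<and>
     A \<subseteq> \<Sigma> \<and>
     (\<forall>b1\<in>\<Sigma>. \<forall>b2\<in>\<Sigma>. \<forall>b3\<in>\<Sigma>. \<forall>b4\<in>\<Sigma>.
        b1 \<noteq> b2 \<and> b3 \<noteq> b4 \<and> line_through b1 b2 \<noteq> line_through b3 b4
        \<and> \<not> lines_parallel b1 b2 b3 b4 \<longrightarrow>
        (\<forall>p. p \<in> line_through b1 b2 \<inter> line_through b3 b4 \<longrightarrow> p \<in> \<Sigma>)) \<and>
     (\<forall>b1\<in>\<Sigma>. \<forall>b2\<in>\<Sigma>. b1 \<noteq> b2 \<longrightarrow>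
        (\<forall>G \<in> Ls \<union> Cs. \<forall>p. isolated_pt_of p (line_through b1 b2 \<inter> G) \<longrightarrow> p \<in> \<Sigma>))"

end

theory Submission
  imports Defs "HOL-Computational_Algebra.Primes"
begin

text \<open>
  The set \<open>\<Sigma>\<close> is the image of the rational plane \<open>\<rat> \<times> \<rat>\<close> under the shear
  \<open>(a, c) \<mapsto> (a + \<surd>2 c, c)\<close>. Being a linear bijection of determinant 1, the shear preserves
  lines and the cross product, so \<open>\<Sigma>\<close> inherits density and closure under line intersections
  from \<open>\<rat> \<times> \<rat>\<close>. On the other hand it turns the inner product into
  \<open>(a a' + 3 c c') + \<surd>2 (a c' + c a')\<close>; by irrationality of \<open>\<surd>2\<close> both rational parts
  vanish at a right angle, and then irrationality of \<open>\<surd>3\<close> forces one direction to be zero.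
\<close>

lemma sqrt_prime_irrational:
  fixes p :: nat
  assumes "prime p"
  shows "sqrt p \<notin> \<rat>"
proof
  from \<open>prime p\<close> have p: "p > 1" by (rule prime_gt_1_nat)
  assume "sqrt p \<in> \<rat>"
  then obtain m n :: nat
    where n: "n \<noteq> 0" and sqrt_rat: "\<bar>sqrt p\<bar> = m / n" and "coprime m n"
    by (rule Rats_abs_nat_div_natE)
  have eq: "m\<^sup>2 = p * n\<^sup>2"
  proof -
    from n and sqrt_rat have "m = \<bar>sqrt p\<bar> * n" by simp
    then have "m\<^sup>2 = (sqrt p)\<^sup>2 * n\<^sup>2" by (simp add: power_mult_distrib)
    then show ?thesis by (simp flip: of_nat_power of_nat_mult)
  qed
  have "p dvd m \<and> p dvd n"
  proof
    from eq have "p dvd m\<^sup>2" ..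
    with \<open>prime p\<close> show "p dvd m" by (rule prime_dvd_power)
    then obtain k where "m = p * k" ..
    with eq have "p * n\<^sup>2 = p\<^sup>2 * k\<^sup>2" by algebra
    with p have "n\<^sup>2 = p * k\<^sup>2" by (simp add: power2_eq_square)
    then have "p dvd n\<^sup>2" ..
    with \<open>prime p\<close> show "p dvd n" by (rule prime_dvd_power)
  qed
  then have "p dvd gcd m n" by simp
  with \<open>coprime m n\<close> p show False by simp
qed

lemma Rats_square_eq_prime_times_square:
  fixes a c :: real and p :: nat
  assumes "a \<in> \<rat>" "c \<in> \<rat>" "prime p" "a\<^sup>2 = p * c\<^sup>2"
  shows "a = 0 \<and> c = 0"
proof (cases "c = 0")
  case True
  with assms show ?thesis by simp
next
  case False
  with assms have "(a / c)\<^sup>2 = p" by (simp add: power_divide)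
  then have "sqrt p = \<bar>a / c\<bar>" by (metis real_sqrt_abs)
  moreover have "\<bar>a / c\<bar> \<in> \<rat>" using assms by simp
  ultimately show ?thesis using sqrt_prime_irrational[OF \<open>prime p\<close>] by simp
qed

lemma Rats_plus_sqrt2_times_eq_0:
  fixes u v :: real
  assumes "u \<in> \<rat>" "v \<in> \<rat>" "u + sqrt 2 * v = 0"
  shows "u = 0 \<and> v = 0"
proof -
  from assms(3) have "u\<^sup>2 = 2 * v\<^sup>2" by (simp add: eq_neg_iff_add_eq_0 [symmetric] power_mult_distrib)
  with assms(1,2) show ?thesis
    using Rats_square_eq_prime_times_square[of u v 2] by simp
qed

lemma linear_image_line_through:
  assumes "linear f"
  shows "f ` line_through a b = line_through (f a) (f b)"
proof -
  have image_point: "f (a + t *\<^sub>R (b - a)) = f a + t *\<^sub>R (f b - f a)" for t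
    by (simp add: assms linear_add linear_diff linear_scale)
  show ?thesis
    unfolding line_through_def by (auto simp flip: image_point)
qed

lemma cross2_add_left: "cross2 (u + u') v = cross2 u v + cross2 u' v"
  by (simp add: cross2_def algebra_simps)

lemma cross2_scaleR_left: "cross2 (c *\<^sub>R u) v = c * cross2 u v"
  by (simp add: cross2_def algebra_simps)

lemma cross2_self: "cross2 u u = 0"
  by (simp add: cross2_def)

lemma line_intersection_parameter:
  assumes "p = b1 + t *\<^sub>R (b2 - b1)" "p \<in> line_through b3 b4"
  shows "t * cross2 (b2 - b1) (b4 - b3) = cross2 (b3 - b1) (b4 - b3)"
proof -
  from assms(2) obtain s where "p = b3 + s *\<^sub>R (b4 - b3)"
    by (auto simp: line_through_def)
  with assms(1) have "t *\<^sub>R (b2 - b1) = (b3 - b1) + s *\<^sub>R (b4 - b3)"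
    by (simp add: algebra_simps)
  then have "cross2 (t *\<^sub>R (b2 - b1)) (b4 - b3) = cross2 ((b3 - b1) + s *\<^sub>R (b4 - b3)) (b4 - b3)"
    by simp
  then show ?thesis
    by (simp add: cross2_add_left cross2_scaleR_left cross2_self)
qed

lemma Rats_line_intersection:
  assumes "b1 \<in> \<rat> \<times> \<rat>" "b2 \<in> \<rat> \<times> \<rat>" "b3 \<in> \<rat> \<times> \<rat>" "b4 \<in> \<rat> \<times> \<rat>"
    and "\<not> lines_parallel b1 b2 b3 b4"
    and "p \<in> line_through b1 b2" "p \<in> line_through b3 b4"
  shows "p \<in> \<rat> \<times> \<rat>"
proof -
  from assms(6) obtain t where p: "p = b1 + t *\<^sub>R (b2 - b1)"
    by (auto simp: line_through_def)
  have "t = cross2 (b3 - b1) (b4 - b3) / cross2 (b2 - b1) (b4 - b3)"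
    using line_intersection_parameter[OF p assms(7)] assms(5)
    by (simp add: lines_parallel_def field_simps)
  then have "t \<in> \<rat>"
    using assms(1-4) by (auto simp: cross2_def)
  with assms(1,2) show ?thesis
    by (auto simp: p)
qed

definition skew :: "pt \<Rightarrow> pt" where
  "skew z = (fst z + sqrt 2 * snd z, snd z)"

lemma linear_skew: "linear skew"
  by (rule linearI) (auto simp: skew_def algebra_simps)

lemma bij_skew: "bij skew"
proof (rule bijI)
  show "inj skew" by (rule injI) (auto simp: skew_def prod_eq_iff)
  show "surj skew"
  proof (rule surjI)
    show "skew (fst z - sqrt 2 * snd z, snd z) = z" for z by (simp add: skew_def)
  qed
qed

lemma cross2_skew: "cross2 (skew u) (skew v) = cross2 u v"
  by (simp add: skew_def cross2_def algebra_simps)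

lemma inner_skew:
  "inner (skew u) (skew v) =
     (fst u * fst v + 3 * snd u * snd v) + sqrt 2 * (fst u * snd v + snd u * fst v)"
proof -
  have "sqrt 2 * sqrt 2 = (2::real)" by simp
  then show ?thesis
    by (simp add: skew_def inner_prod_def algebra_simps)
qed

definition skew_grid :: "pt set" where
  "skew_grid = skew ` (\<rat> \<times> \<rat>)"

lemma skew_gridE:
  assumes "b \<in> skew_grid"
  obtains q where "q \<in> \<rat> \<times> \<rat>" "b = skew q"
  using assms unfolding skew_grid_def by blast

lemma closure_skew_grid: "closure skew_grid = UNIV"
proof -
  have "closure skew_grid = skew ` closure (\<rat> \<times> \<rat>)"
    unfolding skew_grid_def
    using linear_skew bij_skew by (simp add: closure_injective_linear_image bij_is_inj)
  also have "\<dots> = UNIV"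
    using bij_skew by (simp add: closure_Times Rats_closure_real bij_is_surj)
  finally show ?thesis .
qed

lemma skew_grid_line_intersection:
  assumes "b1 \<in> skew_grid" "b2 \<in> skew_grid" "b3 \<in> skew_grid" "b4 \<in> skew_grid"
    and "\<not> lines_parallel b1 b2 b3 b4"
    and "p \<in> line_through b1 b2" "p \<in> line_through b3 b4"
  shows "p \<in> skew_grid"
proof -
  obtain q1 q2 q3 q4 where q: "q1 \<in> \<rat> \<times> \<rat>" "q2 \<in> \<rat> \<times> \<rat>"
      "q3 \<in> \<rat> \<times> \<rat>" "q4 \<in> \<rat> \<times> \<rat>"
    and b: "b1 = skew q1" "b2 = skew q2" "b3 = skew q3" "b4 = skew q4"
    using assms(1-4) by (elim skew_gridE)
  have inj: "inj skew" using bij_skew by (rule bij_is_inj)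
  obtain q where q_p: "p = skew q" using bij_skew by (metis bij_is_surj surjD)
  have "skew q \<in> skew ` line_through q1 q2" "skew q \<in> skew ` line_through q3 q4"
    using assms(6,7) by (simp_all add: q_p b linear_image_line_through[OF linear_skew])
  then have "q \<in> line_through q1 q2" "q \<in> line_through q3 q4"
    by (simp_all add: inj_image_mem_iff[OF inj])
  moreover have "\<not> lines_parallel q1 q2 q3 q4"
    using assms(5) by (simp add: lines_parallel_def b linear_diff[OF linear_skew, symmetric] cross2_skew)
  ultimately have "q \<in> \<rat> \<times> \<rat>"
    using Rats_line_intersection[OF q] by blast
  then show ?thesis
    by (simp add: skew_grid_def q_p)
qed

lemma Rats_skew_orthogonal:
  assumes "u \<in> \<rat> \<times> \<rat>" "v \<in> \<rat> \<times> \<rat>" "inner (skew u) (skew v) = 0"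
  shows "u = 0 \<or> v = 0"
proof -
  obtain a1 c1 a2 c2 where uv: "u = (a1, c1)" "v = (a2, c2)" by (cases u, cases v)
  with assms(1,2) have Q: "a1 \<in> \<rat>" "c1 \<in> \<rat>" "a2 \<in> \<rat>" "c2 \<in> \<rat>" by auto
  have E: "a1 * a2 + 3 * c1 * c2 = 0" "a1 * c2 + c1 * a2 = 0"
    using assms(3) Q Rats_plus_sqrt2_times_eq_0[of "a1 * a2 + 3 * c1 * c2" "a1 * c2 + c1 * a2"]
    by (auto simp: inner_skew uv)
  \<comment> \<open>Eliminating between the two equations leaves the norm form \<open>a\<^sup>2 - 3 c\<^sup>2\<close> of \<open>\<rat>(\<surd>3)\<close>.\<close>
  have "a2 * (a1\<^sup>2 - 3 * c1\<^sup>2) = a1 * (a1 * a2 + 3 * c1 * c2) - 3 * c1 * (a1 * c2 + c1 * a2)"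
    by (simp add: algebra_simps power2_eq_square)
  with E have "a2 = 0 \<or> a1\<^sup>2 = 3 * c1\<^sup>2" by simp
  then show ?thesis
  proof
    assume "a2 = 0"
    with E show ?thesis by (auto simp: uv zero_prod_def)
  next
    assume "a1\<^sup>2 = 3 * c1\<^sup>2"
    with Q have "a1 = 0 \<and> c1 = 0"
      using Rats_square_eq_prime_times_square[of a1 c1 3] by simp
    then show ?thesis by (simp add: uv zero_prod_def)
  qed
qed

lemma skew_grid_no_perpendicular:
  assumes "b1 \<in> skew_grid" "b2 \<in> skew_grid" "b3 \<in> skew_grid" "b4 \<in> skew_grid"
    and "b1 \<noteq> b2" "b3 \<noteq> b4"
  shows "inner (b2 - b1) (b4 - b3) \<noteq> 0"
proof -
  obtain q1 q2 q3 q4 where q: "q1 \<in> \<rat> \<times> \<rat>" "q2 \<in> \<rat> \<times> \<rat>"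
      "q3 \<in> \<rat> \<times> \<rat>" "q4 \<in> \<rat> \<times> \<rat>"
    and b: "b1 = skew q1" "b2 = skew q2" "b3 = skew q3" "b4 = skew q4"
    using assms(1-4) by (elim skew_gridE)
  have Q: "q2 - q1 \<in> \<rat> \<times> \<rat>" "q4 - q3 \<in> \<rat> \<times> \<rat>"
    using q by (auto simp: mem_Times_iff)
  have nonzero: "q2 - q1 \<noteq> 0" "q4 - q3 \<noteq> 0"
    using assms(5,6) b by auto
  have "inner (skew (q2 - q1)) (skew (q4 - q3)) \<noteq> 0"
  proof
    assume "inner (skew (q2 - q1)) (skew (q4 - q3)) = 0"
    from Rats_skew_orthogonal[OF Q this] nonzero show False by blast
  qed
  then show ?thesis
    by (simp add: b linear_diff[OF linear_skew])
qed

theorem mainTheorem7: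
  shows "\<exists>\<Sigma>. admissible {} {} {} \<Sigma> \<and>
           (\<forall>b1\<in>\<Sigma>. \<forall>b2\<in>\<Sigma>. \<forall>b3\<in>\<Sigma>. \<forall>b4\<in>\<Sigma>.
              b1 \<noteq> b2 \<and> b3 \<noteq> b4 \<longrightarrow> inner (b2 - b1) (b4 - b3) \<noteq> 0)"
proof (intro exI[of _ skew_grid] conjI)
  show "admissible {} {} {} skew_grid"
    unfolding admissible_def
  proof (intro conjI)
    show "closure skew_grid = UNIV" by (rule closure_skew_grid)
    show "\<forall>b1\<in>skew_grid. \<forall>b2\<in>skew_grid. \<forall>b3\<in>skew_grid. \<forall>b4\<in>skew_grid.
        b1 \<noteq> b2 \<and> b3 \<noteq> b4 \<and> line_through b1 b2 \<noteq> line_through b3 b4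
        \<and> \<not> lines_parallel b1 b2 b3 b4 \<longrightarrow>
        (\<forall>p. p \<in> line_through b1 b2 \<inter> line_through b3 b4 \<longrightarrow> p \<in> skew_grid)"
      by (intro ballI allI impI, elim conjE IntE) (rule skew_grid_line_intersection; assumption)
  qed simp_all
  show "\<forall>b1\<in>skew_grid. \<forall>b2\<in>skew_grid. \<forall>b3\<in>skew_grid. \<forall>b4\<in>skew_grid.
          b1 \<noteq> b2 \<and> b3 \<noteq> b4 \<longrightarrow> inner (b2 - b1) (b4 - b3) \<noteq> 0"
    by (intro ballI impI, elim conjE) (rule skew_grid_no_perpendicular; assumption)
qed

end
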